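(* Let $n = 2^{\alpha} k$ where $\alpha \geq 1$ and $k$ is odd. Suppose that $L$ is a cyclic Galois extension of a field $K$ of characteristic different from $2$, of degree $n$, with Galois group $\mathrm{Gal}(L/K) = \langle \sigma \rangle$. If the order of $\sigma^i$ is even, then there always exists an $n$-subspace of dimension $n/2$ (over $K$) inside $A^i = A^{\sigma^i}$.
   Context: For a finite Galois extension $L/K$, $\mathrm{Alt}_K(L)$ denotes the $K$-space of alternating $K$-bilinear forms (skew-forms) $L \times L \to K$, and $\mathrm{Tr}^L_K(a) = \sum_{\theta \in \mathrm{Gal}(L/K)} \theta(a)$. For $\tau \in \mathrm{Gal}(L/K)$ and $b \in L$ define the skew-form $f_{b,\tau}(x,y) = \mathrm{Tr}^L_K\big(b(x\tau(y) - \tau(x)y)\big)$ for $x,y \in L$, and the subspace $A^{\tau} = \{ f_{b,\tau} : b \in L\}$ of $\mathrm{Alt}_K(L)$. An $n$-subspace of $\mathrm{Alt}_K(L)$ (where $n=[L:K]$) is a $K$-subspace all of whose nonzero skew-forms have rank $n$, i.e. are non-degenerate. *)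

theory Defs
  imports "HOL-Algebra.Multiplicative_Group" "HOL-Algebra.Generated_Groups"
    "HOL-Library.Function_Algebras"
begin

text \<open>A field extension \<open>L/K\<close> is given by a ring homomorphism \<open>\<iota> : K \<rightarrow> L\<close> between fields
  (which is automatically injective); \<open>K\<close> is identified with its image \<open>range \<iota>\<close>.\<close>

locale field_extension =
  fixes \<iota> :: "'k::field \<Rightarrow> 'l::field"
  assumes emb_add: "\<iota> (a + b) = \<iota> a + \<iota> b"
    and emb_mult: "\<iota> (a * b) = \<iota> a * \<iota> b"
    and emb_one: "\<iota> 1 = 1"

definition ext_scale :: "('k::field \<Rightarrow> 'l::field) \<Rightarrow> 'k \<Rightarrow> 'l \<Rightarrow> 'l" where
  "ext_scale \<iota> c x = \<iota> c * x"

definition finite_extension :: "('k::field \<Rightarrow> 'l::field) \<Rightarrow> bool" where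
  "finite_extension \<iota> \<longleftrightarrow> (\<exists>B. finite B \<and> module.span (ext_scale \<iota>) B = UNIV)"

definition ext_degree :: "('k::field \<Rightarrow> 'l::field) \<Rightarrow> nat" where
  "ext_degree \<iota> = vector_space.dim (ext_scale \<iota>) UNIV"

definition Gal_carrier :: "('k::field \<Rightarrow> 'l::field) \<Rightarrow> ('l \<Rightarrow> 'l) set" where
  "Gal_carrier \<iota> = {\<theta>. bij \<theta> \<and> (\<forall>x y. \<theta> (x + y) = \<theta> x + \<theta> y) \<and>
     (\<forall>x y. \<theta> (x * y) = \<theta> x * \<theta> y) \<and> (\<forall>c. \<theta> (\<iota> c) = \<iota> c)}"

definition Gal :: "('k::field \<Rightarrow> 'l::field) \<Rightarrow> ('l \<Rightarrow> 'l) monoid" where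
  "Gal \<iota> = \<lparr>carrier = Gal_carrier \<iota>, monoid.mult = (\<circ>), one = id\<rparr>"

definition galois_extension :: "('k::field \<Rightarrow> 'l::field) \<Rightarrow> bool" where
  "galois_extension \<iota> \<longleftrightarrow> field_extension \<iota> \<and> finite_extension \<iota> \<and>
     {x. \<forall>\<theta>\<in>carrier (Gal \<iota>). \<theta> x = x} = range \<iota>"

text \<open>For a Galois extension the sum below lies in \<open>range \<iota>\<close> (lemma \<open>emb_Tr\<close>), so that
  it can be pulled back to \<open>K\<close>.\<close>

definition Tr :: "('k::field \<Rightarrow> 'l::field) \<Rightarrow> 'l \<Rightarrow> 'k" where
  "Tr \<iota> a = the_inv \<iota> (\<Sum>\<theta>\<in>carrier (Gal \<iota>). \<theta> a)"

definition Alt :: "('k::field \<Rightarrow> 'l::field) \<Rightarrow> ('l \<Rightarrow> 'l \<Rightarrow> 'k) set" where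
  "Alt \<iota> = {f. (\<forall>x. Vector_Spaces.linear (ext_scale \<iota>) (*) (f x)) \<and>
     (\<forall>y. Vector_Spaces.linear (ext_scale \<iota>) (*) (\<lambda>x. f x y)) \<and> (\<forall>x. f x x = 0)}"

definition form_scale :: "'k::field \<Rightarrow> ('l \<Rightarrow> 'l \<Rightarrow> 'k) \<Rightarrow> ('l \<Rightarrow> 'l \<Rightarrow> 'k)" where
  "form_scale c f = (\<lambda>x y. c * f x y)"

definition functional_scale :: "'k::field \<Rightarrow> ('l \<Rightarrow> 'k) \<Rightarrow> ('l \<Rightarrow> 'k)" where
  "functional_scale c g = (\<lambda>y. c * g y)"

text \<open>The rank of a bilinear form is the rank of the induced linear map
  \<open>x \<mapsto> f(x, \<cdot>)\<close> from \<open>L\<close> to its dual.\<close>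

definition form_rank :: "('l \<Rightarrow> 'l \<Rightarrow> 'k::field) \<Rightarrow> nat" where
  "form_rank f = vector_space.dim functional_scale (range f)"

definition n_subspace :: "('k::field \<Rightarrow> 'l::field) \<Rightarrow> ('l \<Rightarrow> 'l \<Rightarrow> 'k) set \<Rightarrow> bool" where
  "n_subspace \<iota> W \<longleftrightarrow> module.subspace form_scale W \<and> W \<subseteq> Alt \<iota> \<and>
     (\<forall>f\<in>W. f \<noteq> 0 \<longrightarrow> form_rank f = ext_degree \<iota>)"

definition skew_form ::
    "('k::field \<Rightarrow> 'l::field) \<Rightarrow> 'l \<Rightarrow> ('l \<Rightarrow> 'l) \<Rightarrow> 'l \<Rightarrow> 'l \<Rightarrow> 'k" where
  "skew_form \<iota> b \<tau> = (\<lambda>x y. Tr \<iota> (b * (x * \<tau> y - \<tau> x * y)))"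

definition A_space :: "('k::field \<Rightarrow> 'l::field) \<Rightarrow> ('l \<Rightarrow> 'l) \<Rightarrow> ('l \<Rightarrow> 'l \<Rightarrow> 'k) set" where
  "A_space \<iota> \<tau> = {skew_form \<iota> b \<tau> | b. True}"

context field_extension
begin

lemma emb_zero: "\<iota> 0 = 0"
  using emb_add[of 0 0] by (metis add.right_neutral add_left_cancel)

lemma emb_minus: "\<iota> (- a) = - \<iota> a"
  using emb_add[of a "- a"] by (simp add: emb_zero eq_neg_iff_add_eq_0 add.commute)

lemma emb_eq_zero: "\<iota> a = 0 \<longleftrightarrow> a = 0"
proof
  assume "\<iota> a = 0"
  then have "\<iota> (a * inverse a) = 0" by (simp add: emb_mult)
  then show "a = 0" using emb_one by (cases "a = 0") auto
qed (simp add: emb_zero)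

lemma inj_emb: "inj \<iota>"
proof (rule injI)
  fix a b assume "\<iota> a = \<iota> b"
  then have "\<iota> (a + - b) = 0" unfolding emb_add emb_minus by simp
  then show "a = b" by (simp add: emb_eq_zero)
qed

lemma vector_space_ext: "vector_space (ext_scale \<iota>)"
  by unfold_locales (simp_all add: ext_scale_def emb_add emb_mult emb_one algebra_simps)

end

lemma vector_space_form: "vector_space form_scale"
  by unfold_locales (auto simp: form_scale_def fun_eq_iff algebra_simps)

lemma vector_space_functional: "vector_space functional_scale"
  by unfold_locales (auto simp: functional_scale_def fun_eq_iff algebra_simps)

lemma Gal_simps [simp]:
  "carrier (Gal \<iota>) = Gal_carrier \<iota>" "monoid.mult (Gal \<iota>) = (\<circ>)" "one (Gal \<iota>) = id"
  by (simp_all add: Gal_def)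

lemma Gal_group: "group (Gal \<iota>)"
proof (rule groupI; (unfold Gal_simps)?)
  fix f g assume "f \<in> Gal_carrier \<iota>" "g \<in> Gal_carrier \<iota>"
  then show "f \<circ> g \<in> Gal_carrier \<iota>" by (auto simp: Gal_carrier_def intro: bij_comp)
next
  show "id \<in> Gal_carrier \<iota>" by (auto simp: Gal_carrier_def)
next
  fix f assume f: "f \<in> Gal_carrier \<iota>"
  then have b: "bij f" by (simp add: Gal_carrier_def)
  then have s: "\<And>x. f (the_inv f x) = x" and i: "\<And>x. the_inv f (f x) = x"
    by (auto simp: bij_def the_inv_f_f f_the_inv_into_f)
  have inj: "f x = f y \<Longrightarrow> x = y" for x y using b by (auto simp: bij_def inj_def)
  have "the_inv f \<in> Gal_carrier \<iota>"
    unfolding Gal_carrier_def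
  proof (intro CollectI conjI allI)
    show "bij (the_inv f)" using b by (metis bij_betw_the_inv_into)
    show "the_inv f (x + y) = the_inv f x + the_inv f y" for x y
      by (rule inj) (use f in \<open>simp add: s Gal_carrier_def\<close>)
    show "the_inv f (x * y) = the_inv f x * the_inv f y" for x y
      by (rule inj) (use f in \<open>simp add: s Gal_carrier_def\<close>)
    show "the_inv f (\<iota> c) = \<iota> c" for c
      by (rule inj) (use f in \<open>simp add: s Gal_carrier_def\<close>)
  qed
  moreover have "the_inv f \<circ> f = id" by (auto simp: i)
  ultimately show "\<exists>g\<in>Gal_carrier \<iota>. g \<circ> f = id" by blast
qed (auto simp: comp_assoc)

lemma emb_Tr:
  assumes "galois_extension \<iota>"
  shows "\<iota> (Tr \<iota> a) = (\<Sum>\<theta>\<in>carrier (Gal \<iota>). \<theta> a)"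
proof -
  interpret G: group "Gal \<iota>" by (rule Gal_group)
  interpret field_extension \<iota> using assms by (simp add: galois_extension_def)
  let ?s = "\<Sum>\<theta>\<in>carrier (Gal \<iota>). \<theta> a"
  have "\<phi> ?s = ?s" if \<phi>: "\<phi> \<in> carrier (Gal \<iota>)" for \<phi>
  proof -
    have add: "\<phi> (x + y) = \<phi> x + \<phi> y" for x y using \<phi> by (simp add: Gal_carrier_def)
    have zero: "\<phi> 0 = 0" using add[of 0 0] by (metis add.right_neutral add_left_cancel)
    have "\<phi> ?s = (\<Sum>\<theta>\<in>carrier (Gal \<iota>). \<phi> (\<theta> a))"
      by (induction "carrier (Gal \<iota>)" rule: infinite_finite_induct)
        (simp_all add: sum_comp_morphism[symmetric, unfolded comp_def] zero add)
    also have "\<dots> = (\<Sum>\<theta>\<in>(\<lambda>\<theta>. \<phi> \<circ> \<theta>) ` carrier (Gal \<iota>). \<theta> a)"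
      using G.inj_on_cmult[OF \<phi>] by (simp only: Gal_simps sum.reindex) (simp only: comp_def)
    also have "(\<lambda>\<theta>. \<phi> \<circ> \<theta>) ` carrier (Gal \<iota>) = carrier (Gal \<iota>)"
      using G.surj_const_mult[OF \<phi>] by simp
    finally show ?thesis .
  qed
  then have "?s \<in> range \<iota>" using assms by (auto simp: galois_extension_def)
  then show ?thesis unfolding Tr_def by (rule f_the_inv_into_f[OF inj_emb])
qed

text \<open>Full rank is the same as being non-degenerate.\<close>

lemma form_rank_eq_degree_iff:
  assumes "field_extension \<iota>" and fin: "finite_extension \<iota>" and f: "f \<in> Alt \<iota>"
  shows "form_rank f = ext_degree \<iota> \<longleftrightarrow> (\<forall>x. (\<forall>y. f x y = 0) \<longrightarrow> x = 0)"
proof -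
  interpret E: field_extension \<iota> by fact
  interpret L: vector_space "ext_scale \<iota>" by (rule E.vector_space_ext)
  interpret D: vector_space "functional_scale :: 'a \<Rightarrow> ('b \<Rightarrow> 'a) \<Rightarrow> _"
    by (rule vector_space_functional)
  obtain S where S: "finite S" "L.span S = UNIV" using fin by (auto simp: finite_extension_def)
  interpret P: vector_space_pair "ext_scale \<iota>" "functional_scale :: 'a \<Rightarrow> ('b \<Rightarrow> 'a) \<Rightarrow> _" ..
  have lin: "Vector_Spaces.linear (ext_scale \<iota>) (*) (\<lambda>x. f x y)" for y
    using f by (simp add: Alt_def)
  have add: "f (u + v) y = f u y + f v y" for u v y
    using module_hom.add[OF Vector_Spaces.linear.axioms(3)[OF lin]] .
  have scale: "f (ext_scale \<iota> c u) y = c * f u y" for c u y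
    using module_hom.scale[OF Vector_Spaces.linear.axioms(3)[OF lin]] .
  have linf: "Vector_Spaces.linear (ext_scale \<iota>) functional_scale f"
  proof unfold_locales
    show "f (u + v) = f u + f v" for u v by (rule ext) (simp only: plus_fun_apply add)
    show "f (ext_scale \<iota> c u) = functional_scale c (f u)" for c u
      by (rule ext) (simp only: functional_scale_def scale)
  qed
  have span: "D.span (f ` B) = range f" if "L.span B = UNIV" for B
    using P.linear_span_image[OF linf, of B] that by simp
  show ?thesis
  proof
    assume r: "form_rank f = ext_degree \<iota>"
    show "\<forall>x. (\<forall>y. f x y = 0) \<longrightarrow> x = 0"
    proof (intro allI impI, rule ccontr)
      fix x assume x: "\<forall>y. f x y = 0" "x \<noteq> 0"
      then have fx: "f x = 0" by auto
      have "L.independent {x}" using x(2) by simp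
      then obtain B where B: "{x} \<subseteq> B" "L.independent B" "L.span B = UNIV"
        using L.maximal_independent_subset_extend[of "{x}" UNIV] by (metis subset_UNIV top.extremum_uniqueI)
      have fB: "finite B" using L.independent_span_bound[OF S(1) B(2)] S(2) by simp
      have cB: "card B = ext_degree \<iota>"
        using L.dim_eq_card[of B UNIV] B(2,3) by (simp add: ext_degree_def)
      have "range f = D.span (f ` (B - {x}))"
      proof -
        have "f ` B = insert 0 (f ` (B - {x}))" using B(1) fx by auto
        then show ?thesis using span[OF B(3)] by (simp add: D.span_insert_0)
      qed
      then have "D.dim (range f) \<le> card (f ` (B - {x}))"
        using D.dim_le_card[of "range f" "f ` (B - {x})"] fB by simp
      also have "\<dots> \<le> card (B - {x})" by (rule card_image_le) (use fB in simp)
      also have "\<dots> < card B" using fB B(1) by (intro psubset_card_mono) auto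
      finally show False using r cB by (simp add: form_rank_def)
    qed
  next
    assume nd: "\<forall>x. (\<forall>y. f x y = 0) \<longrightarrow> x = 0"
    have inj: "inj f"
    proof (rule injI)
      fix u v assume "f u = f v"
      then have "f (u - v) y = 0" for y using add[of "u - v" v y] by simp
      then show "u = v" using nd by (metis right_minus_eq)
    qed
    obtain B where B: "L.independent B" "L.span B = UNIV"
      using L.maximal_independent_subset[of UNIV] by (metis top.extremum_uniqueI)
    have "D.independent (f ` B)"
      using P.linear_independent_injective_image[OF linf B(1)] inj by (auto intro: inj_on_subset)
    then have "D.dim (range f) = card (f ` B)" using span[OF B(2)] by (metis D.dim_span_eq_card_independent)
    also have "\<dots> = card B" using inj by (auto intro: card_image inj_on_subset)
    also have "\<dots> = ext_degree \<iota>"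
      using L.dim_eq_card[of B UNIV] B by (simp add: ext_degree_def)
    finally show "form_rank f = ext_degree \<iota>" by (simp add: form_rank_def)
  qed
qed

end

theory Submission
  imports Defs
begin

text \<open>
  Let \<open>\<tau>\<close> be an automorphism of even order \<open>2 r\<close> and let \<open>\<rho> = \<tau>\<^sup>r\<close>, an involution.
  The wanted subspace consists of the forms \<open>f\<^bsub>b,\<tau>\<^esub>\<close> with \<open>b\<close> in the \<open>(-1)\<close>-eigenspace
  \<open>U\<close> of \<open>\<rho>\<close>.  Since \<open>\<rho>\<close> is diagonalizable with eigenvalues \<open>1\<close> and \<open>-1\<close>, and
  multiplication by a nonzero element of \<open>U\<close> exchanges its two eigenspaces, \<open>U\<close> has half the
  dimension of \<open>L\<close> (\<open>dim_anti_invariants\<close>).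

  The heart is that \<open>f\<^bsub>b,\<tau>\<^esub>\<close> is non-degenerate for every nonzero \<open>b\<close> in \<open>U\<close>
  (\<open>skew_form_nondegenerate\<close>).  As the trace form is non-degenerate, \<open>x\<close> lies in the radical
  only if \<open>b x = \<tau>(b) \<tau>\<^sup>2(x)\<close> (\<open>skew_form_radical\<close>).  If \<open>x \<noteq> 0\<close>, this equation has two
  consequences.  Multiplied by \<open>\<tau>(x)\<close>, it says that \<open>b x \<tau>(x)\<close> is fixed by \<open>\<tau>\<close>, hence by
  \<open>\<rho>\<close>; as \<open>\<rho>\<close> negates \<open>b\<close>, it negates \<open>x \<tau>(x)\<close>, that is, \<open>y = \<rho>(x) / x\<close> satisfies
  \<open>y \<tau>(y) = -1\<close>.  Divided into its image under \<open>\<rho>\<close>, it says that \<open>\<tau>\<^sup>2(y) = y\<close>, so that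
  \<open>\<rho>(y)\<close> is \<open>y\<close> or \<open>\<tau>(y)\<close> according to the parity of \<open>r\<close>.  But \<open>y \<rho>(y) = 1\<close> since
  \<open>\<rho>\<close> is an involution, and either parity now yields \<open>1 = -1\<close>.

  In particular \<open>b \<mapsto> f\<^bsub>b,\<tau>\<^esub>\<close> is injective on \<open>U\<close>, so the dimension is preserved.
  Finiteness of the Galois group and non-degeneracy of the trace form both come from Dedekind's
  theorem on the independence of characters (\<open>characters_independent\<close>).
\<close>

section \<open>Independence of characters and the trace\<close>

text \<open>Dedekind's argument: if \<open>f \<noteq> g\<close> differ at \<open>a\<close>, comparing a relation evaluated at
  \<open>a * x\<close> with \<open>g a\<close> times the relation at \<open>x\<close> eliminates \<open>g\<close> and multiplies the
  coefficient of \<open>f\<close> by \<open>f a - g a \<noteq> 0\<close>.\<close>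
lemma characters_independent:
  fixes S :: "('a::monoid_mult \<Rightarrow> 'b::field) set"
  assumes one: "\<And>f. f \<in> S \<Longrightarrow> f 1 = 1"
    and mult: "\<And>f x y. f \<in> S \<Longrightarrow> f (x * y) = f x * f y"
  shows "\<not> module.dependent functional_scale S"
proof -
  interpret D: vector_space "functional_scale :: 'b \<Rightarrow> ('a \<Rightarrow> 'b) \<Rightarrow> _"
    by (rule vector_space_functional)
  have zero: "\<forall>f\<in>T. u f = 0"
    if "finite T" "T \<subseteq> S" "\<And>x. (\<Sum>f\<in>T. u f * f x) = 0" for T and u :: "_ \<Rightarrow> 'b"
    using that
  proof (induction T arbitrary: u rule: finite_induct)
    case (insert g T)
    have rel: "u g * g x + (\<Sum>f\<in>T. u f * f x) = 0" for x
      using insert.prems(2)[of x] insert.hyps by simp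
    have T: "u f = 0" if f: "f \<in> T" for f
    proof -
      have "f \<noteq> g" using f insert.hyps by auto
      then obtain a where a: "f a \<noteq> g a" by auto
      have "(\<Sum>h\<in>T. (u h * (h a - g a)) * h x) = 0" for x
      proof -
        have "(\<Sum>h\<in>T. (u h * (h a - g a)) * h x)
            = (\<Sum>h\<in>T. u h * h (a * x)) - g a * (\<Sum>h\<in>T. u h * h x)"
          unfolding sum_distrib_left sum_subtractf[symmetric]
          by (rule sum.cong) (use insert.prems(1) in \<open>auto simp: mult algebra_simps\<close>)
        also have "\<dots> = - (u g * g (a * x)) + g a * (u g * g x)"
          using rel[of "a * x", unfolded add_eq_0_iff] rel[of x, unfolded add_eq_0_iff] by simp
        also have "\<dots> = 0" using insert.prems(1) by (simp add: mult)
        finally show ?thesis .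
      qed
      from insert.IH[OF _ this] have "u f * (f a - g a) = 0"
        using f insert.prems(1) by auto
      then show ?thesis using a by simp
    qed
    then have "u g = 0" using rel[of 1] insert.prems(1) by (simp add: one)
    with T show ?case by auto
  qed simp
  show ?thesis
    unfolding D.independent_explicit_finite_subsets
  proof (intro allI impI)
    fix T u assume T: "T \<subseteq> S" "finite T" "(\<Sum>f\<in>T. functional_scale (u f) f) = 0"
    have "(\<Sum>f\<in>T. u f * f x) = 0" for x
    proof -
      have "(\<Sum>f\<in>T. functional_scale (u f) f) x = (\<Sum>f\<in>T. u f * f x)"
        using T(2) by (induction T rule: finite_induct) (simp_all add: functional_scale_def)
      then show ?thesis using T(3) by simp
    qed
    from zero[OF T(2,1) this] show "\<forall>f\<in>T. u f = 0" .
  qed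
qed

lemma Gal_add: "\<theta> \<in> Gal_carrier \<iota> \<Longrightarrow> \<theta> (x + y) = \<theta> x + \<theta> y"
  and Gal_mult: "\<theta> \<in> Gal_carrier \<iota> \<Longrightarrow> \<theta> (x * y) = \<theta> x * \<theta> y"
  and Gal_emb: "\<theta> \<in> Gal_carrier \<iota> \<Longrightarrow> \<theta> (\<iota> c) = \<iota> c"
  and Gal_bij: "\<theta> \<in> Gal_carrier \<iota> \<Longrightarrow> bij \<theta>"
  by (auto simp: Gal_carrier_def)

lemma Gal_zero: "\<theta> \<in> Gal_carrier \<iota> \<Longrightarrow> \<theta> 0 = 0"
  using Gal_add[of \<theta> \<iota> 0 0] by (metis add.right_neutral add_left_cancel)

lemma Gal_eq_zero_iff: "\<theta> \<in> Gal_carrier \<iota> \<Longrightarrow> \<theta> x = 0 \<longleftrightarrow> x = 0"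
  by (metis Gal_zero Gal_bij bij_pointE)

lemma Gal_one: "\<theta> \<in> Gal_carrier \<iota> \<Longrightarrow> \<theta> 1 = 1"
  using Gal_mult[of \<theta> \<iota> 1 1] Gal_eq_zero_iff[of \<theta> \<iota> 1] by simp

lemma Gal_minus: "\<theta> \<in> Gal_carrier \<iota> \<Longrightarrow> \<theta> (- x) = - \<theta> x"
  using Gal_add[of \<theta> \<iota> x "- x"] by (simp add: Gal_zero eq_neg_iff_add_eq_0 add.commute)

lemma Gal_diff: "\<theta> \<in> Gal_carrier \<iota> \<Longrightarrow> \<theta> (x - y) = \<theta> x - \<theta> y"
  using Gal_add[of \<theta> \<iota> x "- y"] by (simp add: Gal_minus)

lemma Gal_divide: "\<theta> \<in> Gal_carrier \<iota> \<Longrightarrow> \<theta> (x / y) = \<theta> x / \<theta> y"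
  using Gal_mult[of \<theta> \<iota> "x / y" y]
  by (cases "y = 0") (simp_all add: Gal_zero Gal_eq_zero_iff field_simps)

lemma Gal_independent: "\<not> module.dependent functional_scale (Gal_carrier \<iota>)"
  by (rule characters_independent) (auto simp: Gal_one Gal_mult)

text \<open>Automorphisms are \<open>L\<close>-linearly independent and are determined, together with all their
  \<open>L\<close>-linear combinations, by their values on a finite spanning set \<open>B\<close> of \<open>L\<close> over \<open>K\<close>.
  Restriction to \<open>B\<close> therefore embeds the Galois group as an independent set into the
  finite-dimensional space \<open>L\<^sup>B\<close>.\<close>
lemma finite_Gal:
  fixes \<iota> :: "'k::field \<Rightarrow> 'l::field"
  assumes "field_extension \<iota>" and "finite_extension \<iota>"
  shows "finite (Gal_carrier \<iota>)"
proof -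
  interpret field_extension \<iota> by fact
  interpret L: vector_space "ext_scale \<iota>" by (rule vector_space_ext)
  interpret D: vector_space "functional_scale :: 'l \<Rightarrow> ('l \<Rightarrow> 'l) \<Rightarrow> _"
    by (rule vector_space_functional)
  interpret P: vector_space_pair "functional_scale :: 'l \<Rightarrow> ('l \<Rightarrow> 'l) \<Rightarrow> _"
    "functional_scale :: 'l \<Rightarrow> ('l \<Rightarrow> 'l) \<Rightarrow> _" ..
  obtain B where B: "finite B" "L.span B = UNIV"
    using assms(2) by (auto simp: finite_extension_def)
  \<comment> \<open>\<open>L\<^sup>B\<close> is realized as the functions on \<open>L\<close> that vanish outside \<open>B\<close>.\<close>
  define R :: "('l \<Rightarrow> 'l) \<Rightarrow> 'l \<Rightarrow> 'l" where "R f = (\<lambda>b. if b \<in> B then f b else 0)" for f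
  define \<delta> :: "'l \<Rightarrow> 'l \<Rightarrow> 'l" where "\<delta> b = (\<lambda>x. if x = b then 1 else 0)" for b
  have linR: "Vector_Spaces.linear functional_scale functional_scale R"
    by unfold_locales (auto simp: R_def functional_scale_def fun_eq_iff)
  \<comment> \<open>Restriction is injective only on \<open>K\<close>-linear maps; these contain the span.\<close>
  let ?V = "{f :: 'l \<Rightarrow> 'l. (\<forall>x y. f (x + y) = f x + f y) \<and> (\<forall>c x. f (\<iota> c * x) = \<iota> c * f x)}"
  have "D.subspace ?V"
    by (rule D.subspaceI) (auto simp: functional_scale_def algebra_simps)
  then have V: "D.span (Gal_carrier \<iota>) \<subseteq> ?V"
    by (intro D.span_minimal) (auto simp: Gal_add Gal_mult Gal_emb)
  have inj: "inj_on R (D.span (Gal_carrier \<iota>))"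
  proof (rule inj_onI)
    fix f g assume f: "f \<in> D.span (Gal_carrier \<iota>)" and g: "g \<in> D.span (Gal_carrier \<iota>)"
      and eq: "R f = R g"
    have fg: "f \<in> ?V" "g \<in> ?V" using V f g by blast+
    then have "f (0 + 0) = f 0 + f 0" "g (0 + 0) = g 0 + g 0" by blast+
    then have "f 0 = 0" "g 0 = 0" by (simp_all only: add_0_right add_cancel_right_right)
    then have "L.subspace {x. f x = g x}"
      using fg by (intro L.subspaceI) (auto simp: ext_scale_def)
    moreover have "B \<subseteq> {x. f x = g x}" using eq unfolding R_def fun_eq_iff by (auto split: if_splits)
    ultimately have "L.span B \<subseteq> {x. f x = g x}" by (rule L.span_minimal[rotated])
    then show "f = g" using B(2) by auto
  qed
  have "D.independent (R ` Gal_carrier \<iota>)"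
    by (rule P.linear_independent_injective_image[OF linR Gal_independent inj])
  moreover have "R ` Gal_carrier \<iota> \<subseteq> D.span (\<delta> ` B)"
  proof (rule image_subsetI)
    fix f
    have "R f x = (\<Sum>b\<in>B. functional_scale (f b) (\<delta> b)) x" for x
    proof -
      have "(\<Sum>b\<in>B. functional_scale (f b) (\<delta> b)) x = (\<Sum>b\<in>B. f b * \<delta> b x)"
        using B(1) by (induction B rule: finite_induct) (simp_all add: functional_scale_def)
      also have "\<dots> = (\<Sum>b\<in>B. if b = x then f b else 0)" by (rule sum.cong) (auto simp: \<delta>_def)
      also have "\<dots> = R f x" using B(1) by (simp add: R_def)
      finally show ?thesis by simp
    qed
    then have "R f = (\<Sum>b\<in>B. functional_scale (f b) (\<delta> b))" by auto
    then show "R f \<in> D.span (\<delta> ` B)"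
      by (simp add: D.span_sum D.span_scale D.span_base)
  qed
  ultimately have "finite (R ` Gal_carrier \<iota>)"
    using D.independent_span_bound[of "\<delta> ` B"] B(1) by blast
  then show ?thesis
    by (rule finite_imageD) (rule inj_on_subset[OF inj D.span_superset])
qed

context
  fixes \<iota> :: "'k::field \<Rightarrow> 'l::field"
  assumes galois: "galois_extension \<iota>"
begin

interpretation field_extension \<iota>
  using galois by (simp add: galois_extension_def)

lemma finite_basis: "\<exists>B. finite_dimensional_vector_space (ext_scale \<iota>) B"
proof -
  interpret L: vector_space "ext_scale \<iota>" by (rule vector_space_ext)
  obtain S where S: "finite S" "L.span S = UNIV"
    using galois by (auto simp: galois_extension_def finite_extension_def)
  obtain B where B: "B \<subseteq> S" "L.independent B" "S \<subseteq> L.span B"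
    using L.maximal_independent_subset[of S] by blast
  have "L.span B = UNIV"
    using L.span_minimal[OF B(3) L.subspace_span] S(2) by auto
  then have "finite_dimensional_vector_space (ext_scale \<iota>) B"
    by unfold_locales (use B S in \<open>auto intro: finite_subset\<close>)
  then show ?thesis ..
qed

lemma emb_Tr_Gal: "\<iota> (Tr \<iota> a) = (\<Sum>\<theta>\<in>Gal_carrier \<iota>. \<theta> a)"
  using emb_Tr[OF galois] by simp

lemma Tr_add: "Tr \<iota> (a + b) = Tr \<iota> a + Tr \<iota> b"
  by (rule injD[OF inj_emb]) (simp add: emb_add emb_Tr_Gal Gal_add sum.distrib)

lemma Tr_scale: "Tr \<iota> (\<iota> c * a) = c * Tr \<iota> a"
  by (rule injD[OF inj_emb]) (simp add: emb_mult emb_Tr_Gal Gal_mult Gal_emb sum_distrib_left)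

lemma Tr_zero: "Tr \<iota> 0 = 0"
  using Tr_add[of 0 0] by (metis add.right_neutral add_left_cancel)

lemma Tr_diff: "Tr \<iota> (a - b) = Tr \<iota> a - Tr \<iota> b"
  using Tr_add[of "a - b" b] by simp

lemma Tr_Gal:
  assumes \<tau>: "\<tau> \<in> Gal_carrier \<iota>"
  shows "Tr \<iota> (\<tau> a) = Tr \<iota> a"
proof (rule injD[OF inj_emb])
  interpret G: group "Gal \<iota>" by (rule Gal_group)
  have \<tau>': "\<tau> \<in> carrier (Gal \<iota>)" using \<tau> by simp
  have "(\<Sum>\<theta>\<in>carrier (Gal \<iota>). \<theta> (\<tau> a)) = (\<Sum>\<theta>\<in>carrier (Gal \<iota>). \<theta> a)"
  proof (rule sum.reindex_bij_witness[where i = "\<lambda>\<theta>. \<theta> \<otimes>\<^bsub>Gal \<iota>\<^esub> inv\<^bsub>Gal \<iota>\<^esub> \<tau>"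
        and j = "\<lambda>\<theta>. \<theta> \<otimes>\<^bsub>Gal \<iota>\<^esub> \<tau>"])
    fix \<theta> assume \<theta>: "\<theta> \<in> carrier (Gal \<iota>)"
    show "\<theta> \<otimes>\<^bsub>Gal \<iota>\<^esub> \<tau> \<otimes>\<^bsub>Gal \<iota>\<^esub> inv\<^bsub>Gal \<iota>\<^esub> \<tau> = \<theta>"
      and "\<theta> \<otimes>\<^bsub>Gal \<iota>\<^esub> inv\<^bsub>Gal \<iota>\<^esub> \<tau> \<otimes>\<^bsub>Gal \<iota>\<^esub> \<tau> = \<theta>"
      using \<theta> \<tau>' by (simp_all only: G.m_assoc G.inv_closed G.r_inv G.l_inv G.r_one)
    show "\<theta> \<otimes>\<^bsub>Gal \<iota>\<^esub> \<tau> \<in> carrier (Gal \<iota>)"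
      and "\<theta> \<otimes>\<^bsub>Gal \<iota>\<^esub> inv\<^bsub>Gal \<iota>\<^esub> \<tau> \<in> carrier (Gal \<iota>)"
      using \<theta> \<tau>' by (simp_all only: G.m_closed G.inv_closed)
  qed simp
  then show "\<iota> (Tr \<iota> (\<tau> a)) = \<iota> (Tr \<iota> a)" by (simp add: emb_Tr_Gal)
qed

text \<open>If \<open>c \<noteq> 0\<close>, then \<open>z * c\<close> runs through all of \<open>L\<close>, so the trace would vanish
  identically, a nontrivial relation between the automorphisms.\<close>
lemma Tr_nondegenerate:
  assumes "\<And>z. Tr \<iota> (z * c) = 0"
  shows "c = 0"
proof (rule ccontr)
  assume c: "c \<noteq> 0"
  interpret D: vector_space "functional_scale :: 'l \<Rightarrow> ('l \<Rightarrow> 'l) \<Rightarrow> _"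
    by (rule vector_space_functional)
  have fin: "finite (Gal_carrier \<iota>)"
    using galois by (intro finite_Gal) (simp_all add: galois_extension_def)
  have "(\<Sum>\<theta>\<in>Gal_carrier \<iota>. functional_scale 1 \<theta>) a = 0" for a
  proof -
    have "(\<Sum>\<theta>\<in>Gal_carrier \<iota>. functional_scale 1 \<theta>) a = (\<Sum>\<theta>\<in>Gal_carrier \<iota>. \<theta> a)"
      using fin by (induction rule: finite_induct) (simp_all add: functional_scale_def)
    also have "\<dots> = \<iota> (Tr \<iota> (a / c * c))" using c by (simp add: emb_Tr_Gal)
    finally show ?thesis using assms[of "a / c"] by (simp add: emb_zero)
  qed
  then have "(\<Sum>\<theta>\<in>Gal_carrier \<iota>. functional_scale 1 \<theta>) = 0" by auto
  moreover have "D.independent (Gal_carrier \<iota>)" by (rule Gal_independent)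
  ultimately have "\<forall>\<theta>\<in>Gal_carrier \<iota>. (1::'l) = 0"
    using fin unfolding D.independent_explicit_finite_subsets
    by (elim allE[of _ "Gal_carrier \<iota>"] allE[of _ "\<lambda>_. 1"] impE) (simp_all only: subset_refl)
  moreover have "id \<in> Gal_carrier \<iota>" by (auto simp: Gal_carrier_def)
  ultimately show False by auto
qed

section \<open>The skew-forms of an automorphism\<close>

lemma skew_form_in_Alt:
  assumes \<tau>: "\<tau> \<in> Gal_carrier \<iota>"
  shows "skew_form \<iota> b \<tau> \<in> Alt \<iota>"
proof -
  interpret L: vector_space "ext_scale \<iota>" by (rule vector_space_ext)
  interpret K: vector_space "(*) :: 'k \<Rightarrow> _" by unfold_locales (simp_all add: algebra_simps)
  have "Vector_Spaces.linear (ext_scale \<iota>) (*) (skew_form \<iota> b \<tau> x)" for x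
    by (unfold_locales; unfold skew_form_def ext_scale_def Tr_add[symmetric] Tr_scale[symmetric];
        rule arg_cong[where f = "Tr \<iota>"])
      (simp_all add: Gal_add[OF \<tau>] Gal_mult[OF \<tau>] Gal_emb[OF \<tau>] algebra_simps)
  moreover have "Vector_Spaces.linear (ext_scale \<iota>) (*) (\<lambda>x. skew_form \<iota> b \<tau> x y)" for y
    by (unfold_locales; unfold skew_form_def ext_scale_def Tr_add[symmetric] Tr_scale[symmetric];
        rule arg_cong[where f = "Tr \<iota>"])
      (simp_all add: Gal_add[OF \<tau>] Gal_mult[OF \<tau>] Gal_emb[OF \<tau>] algebra_simps)
  moreover have "skew_form \<iota> b \<tau> x x = 0" for x
    by (simp add: skew_form_def Tr_zero mult.commute)
  ultimately show ?thesis by (simp add: Alt_def)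
qed

lemma linear_skew_form:
  "Vector_Spaces.linear (ext_scale \<iota>) form_scale (\<lambda>b. skew_form \<iota> b \<tau>)"
proof -
  interpret L: vector_space "ext_scale \<iota>" by (rule vector_space_ext)
  interpret F: vector_space "form_scale :: 'k \<Rightarrow> ('l \<Rightarrow> 'l \<Rightarrow> 'k) \<Rightarrow> _"
    by (rule vector_space_form)
  show ?thesis
    by unfold_locales
      (auto simp: fun_eq_iff skew_form_def form_scale_def ext_scale_def distrib_right mult.assoc
        Tr_add Tr_scale)
qed

text \<open>Invariance of the trace under \<open>\<tau>\<close> allows both terms of the form to be written as traces
  of multiples of \<open>\<tau> y\<close>:
  \<open>f\<^bsub>b,\<tau>\<^esub>(x,y) = Tr (\<tau> y * (b * x - \<tau> b * \<tau> (\<tau> x)))\<close>.\<close>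
lemma skew_form_radical:
  assumes \<tau>: "\<tau> \<in> Gal_carrier \<iota>" and rad: "\<And>y. skew_form \<iota> b \<tau> x y = 0"
  shows "b * x = \<tau> b * \<tau> (\<tau> x)"
proof -
  have "Tr \<iota> (z * (b * x - \<tau> b * \<tau> (\<tau> x))) = 0" for z
  proof -
    obtain y where y: "z = \<tau> y" using Gal_bij[OF \<tau>] by (metis bij_pointE)
    have "Tr \<iota> (z * (b * x - \<tau> b * \<tau> (\<tau> x))) = Tr \<iota> (b * x * \<tau> y) - Tr \<iota> (\<tau> (b * \<tau> x * y))"
      unfolding y Tr_diff[symmetric] by (simp add: Gal_mult[OF \<tau>] algebra_simps)
    also have "\<dots> = Tr \<iota> (b * x * \<tau> y) - Tr \<iota> (b * \<tau> x * y)" by (simp only: Tr_Gal[OF \<tau>])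
    also have "\<dots> = skew_form \<iota> b \<tau> x y"
      unfolding skew_form_def Tr_diff[symmetric] by (simp add: algebra_simps)
    finally show ?thesis by (simp add: rad)
  qed
  from Tr_nondegenerate[OF this] show ?thesis by simp
qed

lemma funpow_parity_fixed:
  assumes "f (f y) = y"
  shows "(f ^^ r) y = (if even r then y else f y)"
  using assms by (induction r) auto

text \<open>A nonzero \<open>x\<close> in the radical makes \<open>y = \<rho> x / x\<close>, with \<open>\<rho> = \<tau> ^^ r\<close>, satisfy
  \<open>\<tau> (\<tau> y) = y\<close>, \<open>y * \<tau> y = -1\<close> and \<open>y * \<rho> y = 1\<close>, which is impossible for either
  parity of \<open>r\<close>.\<close>
lemma skew_form_nondegenerate:
  assumes char: "(2::'l) \<noteq> 0" and \<tau>: "\<tau> \<in> Gal_carrier \<iota>"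
    and \<rho>: "\<tau> ^^ r \<in> Gal_carrier \<iota>" "\<And>x. (\<tau> ^^ r) ((\<tau> ^^ r) x) = x"
    and b: "(\<tau> ^^ r) b = - b" "b \<noteq> 0" and rad: "\<And>y. skew_form \<iota> b \<tau> x y = 0"
  shows "x = 0"
proof (rule ccontr)
  assume x: "x \<noteq> 0"
  let ?\<rho> = "\<tau> ^^ r"
  define y where "y = ?\<rho> x / x"
  have comm: "?\<rho> (\<tau> a) = \<tau> (?\<rho> a)" for a by (metis comp_apply funpow_swap1)
  have nz: "\<tau> x \<noteq> 0" "\<tau> b \<noteq> 0" "?\<rho> x \<noteq> 0" "\<tau> (\<tau> x) \<noteq> 0" "\<tau> (?\<rho> x) \<noteq> 0" "\<tau> (\<tau> (?\<rho> x)) \<noteq> 0"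
    using x b Gal_eq_zero_iff[OF \<tau>] Gal_eq_zero_iff[OF \<rho>(1)] by auto
  have eq: "b * x = \<tau> b * \<tau> (\<tau> x)" by (rule skew_form_radical[OF \<tau> rad])
  have eq': "b * ?\<rho> x = \<tau> b * \<tau> (\<tau> (?\<rho> x))"
    using arg_cong[OF eq, of ?\<rho>]
    by (simp add: Gal_mult[OF \<rho>(1)] comm b Gal_minus[OF \<tau>])
  have fix2: "\<tau> (\<tau> y) = y"
  proof -
    have "\<tau> (\<tau> y) = (\<tau> b * \<tau> (\<tau> (?\<rho> x))) / (\<tau> b * \<tau> (\<tau> x))"
      using nz by (simp add: y_def Gal_divide[OF \<tau>])
    also have "\<dots> = y" unfolding eq[symmetric] eq'[symmetric] using b by (simp add: y_def)
    finally show ?thesis .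
  qed
  have norm: "y * \<tau> y = -1"
  proof -
    let ?z = "b * x * \<tau> x"
    have "\<tau> ?z = (\<tau> b * \<tau> (\<tau> x)) * \<tau> x" by (simp add: Gal_mult[OF \<tau>])
    then have "\<tau> ?z = ?z" unfolding eq[symmetric] .
    then have "?\<rho> ?z = ?z" by (induction r) auto
    then have "b * (?\<rho> x * \<tau> (?\<rho> x)) = b * - (x * \<tau> x)"
      by (simp add: Gal_mult[OF \<rho>(1)] comm b(1) mult.assoc minus_equation_iff)
    then have "?\<rho> x * \<tau> (?\<rho> x) = - (x * \<tau> x)" using b(2) mult_left_cancel by blast
    then show ?thesis using x nz by (simp add: y_def Gal_divide[OF \<tau>] field_simps)
  qed
  have inv: "y * ?\<rho> y = 1" using x nz by (simp add: y_def Gal_divide[OF \<rho>(1)] \<rho>(2))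
  have "(1::'l) = -1"
  proof (cases "even r")
    case True
    then have "y * y = 1" using inv funpow_parity_fixed[of \<tau> y, OF fix2] by simp
    then have "y = 1 \<or> y = -1" by (simp add: square_eq_1_iff)
    then have "y * \<tau> y = 1" by (auto simp: Gal_one[OF \<tau>] Gal_minus[OF \<tau>])
    then show ?thesis using norm by simp
  next
    case False
    then show ?thesis using inv norm funpow_parity_fixed[of \<tau> y, OF fix2] by simp
  qed
  then have "(1::'l) + 1 = 0" by (simp add: eq_neg_iff_add_eq_0)
  then show False using char by simp
qed

section \<open>The anti-invariants of an involution\<close>

text \<open>The field is the direct sum of the \<open>(-1)\<close>-eigenspace and the fixed field of \<open>\<rho>\<close>, as
  seen from \<open>a = (a - \<rho> a) / 2 + (a + \<rho> a) / 2\<close>.  Multiplication by any nonzero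
  anti-invariant \<open>w\<close> maps the fixed field onto the eigenspace, so both have the same
  dimension.\<close>
lemma dim_anti_invariants:
  assumes char: "(2::'l) \<noteq> 0" and \<rho>: "\<rho> \<in> Gal_carrier \<iota>" "\<rho> \<noteq> id" "\<And>x. \<rho> (\<rho> x) = x"
  shows "module.subspace (ext_scale \<iota>) {b. \<rho> b = - b}"
    and "ext_degree \<iota> = 2 * vector_space.dim (ext_scale \<iota>) {b. \<rho> b = - b}"
proof -
  interpret L: vector_space "ext_scale \<iota>" by (rule vector_space_ext)
  obtain B where "finite_dimensional_vector_space (ext_scale \<iota>) B" using finite_basis by blast
  then interpret L: finite_dimensional_vector_space "ext_scale \<iota>" B .
  interpret P: finite_dimensional_vector_space_pair_1 "ext_scale \<iota>" B "ext_scale \<iota>" ..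
  let ?U = "{b. \<rho> b = - b}" and ?F = "{a. \<rho> a = a}"
  note hom = Gal_add[OF \<rho>(1)] Gal_mult[OF \<rho>(1)] Gal_emb[OF \<rho>(1)] Gal_zero[OF \<rho>(1)]
    Gal_diff[OF \<rho>(1)] Gal_divide[OF \<rho>(1)] Gal_minus[OF \<rho>(1)]
  show U: "L.subspace ?U" by (rule L.subspaceI) (auto simp: hom ext_scale_def)
  have F: "L.subspace ?F" by (rule L.subspaceI) (auto simp: hom ext_scale_def)
  obtain x where "\<rho> x \<noteq> x" using \<rho>(2) by (metis ext id_apply)
  define w where "w = x - \<rho> x"
  have w: "w \<noteq> 0" "\<rho> w = - w" using \<open>\<rho> x \<noteq> x\<close> by (auto simp: w_def hom \<rho>(3))
  have UF: "?U = (*) w ` ?F"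
  proof (intro equalityI subsetI)
    fix b assume "b \<in> ?U"
    then have "b / w \<in> ?F" "b = w * (b / w)" using w by (auto simp: hom)
    then show "b \<in> (*) w ` ?F" by blast
  qed (auto simp: hom w)
  have lin: "Vector_Spaces.linear (ext_scale \<iota>) (ext_scale \<iota>) ((*) w)"
    by unfold_locales (simp_all add: ext_scale_def algebra_simps)
  have "L.dim ?U = L.dim ?F"
    unfolding UF by (rule P.dim_image_eq[OF lin]) (use w in \<open>auto simp: inj_on_def\<close>)
  moreover have "L.dim {u + v | u v. u \<in> ?U \<and> v \<in> ?F} + L.dim (?U \<inter> ?F) = L.dim ?U + L.dim ?F"
    by (rule L.dim_sums_Int[OF U F])
  moreover have "?U \<inter> ?F = {0}"
  proof -
    have "a = 0" if "\<rho> a = - a" "\<rho> a = a" for a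
    proof -
      have "2 * a = 0" using that by (metis mult_2 add.right_inverse)
      then show ?thesis using char by simp
    qed
    moreover have "0 \<in> ?U \<inter> ?F" by (simp add: hom)
    ultimately show ?thesis by blast
  qed
  moreover have "{u + v | u v. u \<in> ?U \<and> v \<in> ?F} = UNIV"
  proof -
    have "a = (a - \<rho> a) / 2 + (a + \<rho> a) / 2 \<and> (a - \<rho> a) / 2 \<in> ?U \<and> (a + \<rho> a) / 2 \<in> ?F" for a
    proof -
      have "\<rho> 2 = 2" using Gal_add[OF \<rho>(1), of 1 1] by (simp add: Gal_one[OF \<rho>(1)])
      moreover have "(a - \<rho> a) / 2 + (a + \<rho> a) / 2 = a" using char by (simp flip: add_divide_distrib)
      ultimately show ?thesis
        by (simp only: mem_Collect_eq hom \<rho>(3) minus_divide_left minus_diff_eq add.commute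
            simp_thms)
    qed
    then show ?thesis by blast
  qed
  ultimately show "ext_degree \<iota> = 2 * L.dim ?U" by (simp add: ext_degree_def)
qed

text \<open>The image of the anti-invariants of \<open>\<tau> ^^ r\<close>, where \<open>2 * r\<close> is the order of \<open>\<tau>\<close>,
  is the required space; non-degeneracy also gives injectivity of \<open>b \<mapsto> f\<^bsub>b,\<tau>\<^esub>\<close> on them.\<close>
lemma n_subspace_of_even_order:
  assumes char: "(2::'l) \<noteq> 0" and \<tau>: "\<tau> \<in> Gal_carrier \<iota>" and ev: "even (group.ord (Gal \<iota>) \<tau>)"
  shows "\<exists>W. n_subspace \<iota> W \<and> W \<subseteq> A_space \<iota> \<tau> \<and>
    vector_space.dim form_scale W = ext_degree \<iota> div 2"
proof -
  interpret G: group "Gal \<iota>" by (rule Gal_group)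
  have fin: "finite_extension \<iota>" using galois by (simp add: galois_extension_def)
  have finG: "finite (Gal_carrier \<iota>)" by (rule finite_Gal[OF field_extension_axioms fin])
  have \<tau>': "\<tau> \<in> carrier (Gal \<iota>)" using \<tau> by simp
  have pow: "\<tau> [^]\<^bsub>Gal \<iota>\<^esub> j = \<tau> ^^ j" for j :: nat
    by (induction j) (simp_all add: funpow_swap1 fun_eq_iff)
  obtain r where r: "G.ord \<tau> = 2 * r" using ev by blast
  \<comment> \<open>The order is \<open>0\<close>, hence even, for elements of infinite order; finiteness of the group
    excludes this.\<close>
  have "r > 0" using G.ord_ge_1[OF _ \<tau>'] finG r by simp
  let ?\<rho> = "\<tau> ^^ r"
  have \<rho>1: "?\<rho> \<in> Gal_carrier \<iota>" using G.nat_pow_closed[OF \<tau>', of r] by (simp add: pow)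
  have \<rho>2: "?\<rho> \<noteq> id"
  proof
    assume "?\<rho> = id"
    then have "2 * r dvd r" using G.pow_eq_id[OF \<tau>', of r] r by (simp add: pow)
    then show False using \<open>r > 0\<close> by (auto dest: dvd_imp_le)
  qed
  have \<rho>3: "?\<rho> (?\<rho> x) = x" for x
  proof -
    have "\<tau> ^^ (r + r) = id" using G.pow_ord_eq_1[OF \<tau>'] r by (simp add: pow mult_2)
    then show ?thesis by (metis funpow_add comp_apply id_apply)
  qed
  obtain B where "finite_dimensional_vector_space (ext_scale \<iota>) B" using finite_basis by blast
  then interpret L: finite_dimensional_vector_space "ext_scale \<iota>" B .
  interpret F: vector_space "form_scale :: 'k \<Rightarrow> ('l \<Rightarrow> 'l \<Rightarrow> 'k) \<Rightarrow> _"
    by (rule vector_space_form)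
  let ?U = "{b. ?\<rho> b = - b}" and ?f = "\<lambda>b. skew_form \<iota> b \<tau>"
  note U = dim_anti_invariants[OF char \<rho>1 \<rho>2 \<rho>3]
  interpret P: finite_dimensional_vector_space_pair_1 "ext_scale \<iota>" B "form_scale :: 'k \<Rightarrow> ('l \<Rightarrow> 'l \<Rightarrow> 'k) \<Rightarrow> _" ..
  interpret f: Vector_Spaces.linear "ext_scale \<iota>" "form_scale :: 'k \<Rightarrow> ('l \<Rightarrow> 'l \<Rightarrow> 'k) \<Rightarrow> _" ?f
    by (rule linear_skew_form)
  have nondeg: "\<forall>x. (\<forall>y. ?f b x y = 0) \<longrightarrow> x = 0" if "?\<rho> b = - b" "b \<noteq> 0" for b
    using skew_form_nondegenerate[OF char \<tau> \<rho>1 \<rho>3 that] by blast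
  have inj: "inj_on ?f ?U"
    unfolding f.inj_on_iff_eq_0[OF U(1)]
  proof (intro ballI impI, rule ccontr)
    fix b assume "b \<in> ?U" "?f b = 0" "b \<noteq> 0"
    then have "(1::'l) = 0" using nondeg[of b] by simp
    then show False by simp
  qed
  have "n_subspace \<iota> (?f ` ?U)"
    unfolding n_subspace_def
  proof (intro conjI ballI impI)
    show "F.subspace (?f ` ?U)" by (rule f.subspace_image[OF U(1)])
    show "?f ` ?U \<subseteq> Alt \<iota>" using skew_form_in_Alt[OF \<tau>] by blast
    fix g assume "g \<in> ?f ` ?U" "g \<noteq> 0"
    then obtain b where b: "g = ?f b" "?\<rho> b = - b" by blast
    have "b \<noteq> 0"
    proof
      assume "b = 0"
      then have "g = 0" using b(1) f.zero by simp
      then show False using \<open>g \<noteq> 0\<close> by contradiction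
    qed
    show "form_rank g = ext_degree \<iota>"
      unfolding form_rank_eq_degree_iff[OF field_extension_axioms fin skew_form_in_Alt[OF \<tau>]] b(1)
      by (rule nondeg[OF b(2) \<open>b \<noteq> 0\<close>])
  qed
  moreover have "?f ` ?U \<subseteq> A_space \<iota> \<tau>" by (auto simp: A_space_def)
  moreover have "F.dim (?f ` ?U) = ext_degree \<iota> div 2"
    using P.dim_image_eq[OF linear_skew_form, where S = ?U] inj U L.span_eq_iff[THEN iffD2, OF U(1)]
    by simp
  ultimately show ?thesis by blast
qed

end

theorem mainTheorem5:
  fixes \<iota> :: "'k::field \<Rightarrow> 'l::field"
    and \<sigma> :: "'l \<Rightarrow> 'l" and i :: int and n \<alpha> k :: nat
  assumes "n = 2 ^ \<alpha> * k" and "\<alpha> \<ge> 1" and "odd k"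
    and "CHAR('k) \<noteq> 2"
    and "galois_extension \<iota>" and "ext_degree \<iota> = n"
    and "\<sigma> \<in> carrier (Gal \<iota>)" and "generate (Gal \<iota>) {\<sigma>} = carrier (Gal \<iota>)"
    and "even (group.ord (Gal \<iota>) (\<sigma> [^]\<^bsub>Gal \<iota>\<^esub> i))"
  shows "\<exists>W. n_subspace \<iota> W \<and> W \<subseteq> A_space \<iota> (\<sigma> [^]\<^bsub>Gal \<iota>\<^esub> i) \<and>
           vector_space.dim form_scale W = n div 2"
proof -
  interpret field_extension \<iota> using assms(5) by (simp add: galois_extension_def)
  interpret G: group "Gal \<iota>" by (rule Gal_group)
  have "(2::'k) \<noteq> 0"
  proof
    assume "(2::'k) = 0"
    then have "CHAR('k) dvd 2" using of_nat_eq_0_iff_char_dvd[of 2, where 'a = 'k] by simp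
    then have "CHAR('k) \<le> 2" "CHAR('k) \<noteq> 0"
      by (auto dest: dvd_imp_le) (metis dvd_0_left_iff zero_neq_numeral gr0I)
    then show False using assms(4) CHAR_not_1[where 'a = 'k] by linarith
  qed
  then have "(2::'l) \<noteq> 0" using emb_add[of 1 1] emb_one emb_eq_zero[of 2] by simp
  moreover have "\<sigma> [^]\<^bsub>Gal \<iota>\<^esub> i \<in> Gal_carrier \<iota>" using G.int_pow_closed[OF assms(7), of i] by simp
  ultimately show ?thesis using n_subspace_of_even_order[OF assms(5) _ _ assms(9)] assms(6) by simp
qed

end
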